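(* Let $G_1$ and $G_2$ be two finite groups with subgroups $H_1$ and $H_2$ respectively. If $(\psi,\gamma,\beta)$ is an autoisoclinism between the pairs $(H_1,G_1)$ and $(H_2,G_2)$, then \[ \Pr(H_1,\mathrm{Aut}(G_1)) = \Pr(H_2,\mathrm{Aut}(G_2)). \]
   Context: For a subgroup $H$ of a finite group $G$ with automorphism group $\mathrm{Aut}(G)$: $\Pr(H,\mathrm{Aut}(G)) := \dfrac{|\{(x,\alpha)\in H\times \mathrm{Aut}(G) : \alpha(x)=x\}|}{|H||\mathrm{Aut}(G)|}$; $L(H,\mathrm{Aut}(G)) := \{x\in H : \alpha(x)=x \text{ for all } \alpha\in \mathrm{Aut}(G)\}$, which is a normal subgroup of $H$ contained in $H\cap Z(G)$; $[x,\alpha] := x^{-1}\alpha(x)$ for $x\in G$, $\alpha\in\mathrm{Aut}(G)$; and $[H,\mathrm{Aut}(G)]$ is the subgroup of $G$ generated by $\{[x,\alpha] : x\in H,\ \alpha\in\mathrm{Aut}(G)\}$. Let $H_i$ be a subgroup of a group $G_i$ for $i=1,2$, and let $a_{(H_i,\mathrm{Aut}(G_i))} : \frac{H_i}{L(H_i,\mathrm{Aut}(G_i))}\times \mathrm{Aut}(G_i) \to [H_i,\mathrm{Aut}(G_i)]$ be the map given by $a_{(H_i,\mathrm{Aut}(G_i))}(x_iL(H_i,\mathrm{Aut}(G_i)),\alpha_i) = [x_i,\alpha_i]$. An autoisoclinism between the pairs $(H_1,G_1)$ and $(H_2,G_2)$ is a triple $(\psi,\gamma,\beta)$ of group isomorphisms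 $\psi : \frac{H_1}{L(H_1,\mathrm{Aut}(G_1))}\to \frac{H_2}{L(H_2,\mathrm{Aut}(G_2))}$, $\gamma : \mathrm{Aut}(G_1)\to\mathrm{Aut}(G_2)$ and $\beta : [H_1,\mathrm{Aut}(G_1)]\to[H_2,\mathrm{Aut}(G_2)]$ such that $\beta\circ a_{(H_1,\mathrm{Aut}(G_1))} = a_{(H_2,\mathrm{Aut}(G_2))}\circ(\psi\times\gamma)$. *)

theory Defs
  imports Complex_Main "HOL-Algebra.Coset" "HOL-Algebra.Bij" "HOL-Algebra.Generated_Groups"
begin

text \<open>
  Throughout, \<open>H\<close> is (the carrier of) a subgroup of a group \<open>G\<close>. The automorphism group of \<open>G\<close> is
  the library's \<^const>\<open>AutoGroup\<close>, whose carrier \<^term>\<open>auto G\<close> consists of functions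
  that are extensional on \<^term>\<open>carrier G\<close>; hence \<^term>\<open>auto G\<close> has the right cardinality.
\<close>

definition Pr_aut :: "('a, 'm) monoid_scheme \<Rightarrow> 'a set \<Rightarrow> real" where
  "Pr_aut G H = real (card {(x, \<alpha>). x \<in> H \<and> \<alpha> \<in> auto G \<and> \<alpha> x = x}) /
                (real (card H) * real (card (auto G)))"

definition L_aut :: "('a, 'm) monoid_scheme \<Rightarrow> 'a set \<Rightarrow> 'a set" where
  "L_aut G H = {x \<in> H. \<forall>\<alpha> \<in> auto G. \<alpha> x = x}"

definition autocomm :: "('a, 'm) monoid_scheme \<Rightarrow> 'a \<Rightarrow> ('a \<Rightarrow> 'a) \<Rightarrow> 'a" where
  "autocomm G x \<alpha> = inv\<^bsub>G\<^esub> x \<otimes>\<^bsub>G\<^esub> \<alpha> x"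

definition autocomm_subgroup :: "('a, 'm) monoid_scheme \<Rightarrow> 'a set \<Rightarrow> 'a set" where
  "autocomm_subgroup G H = generate G {autocomm G x \<alpha> | x \<alpha>. x \<in> H \<and> \<alpha> \<in> auto G}"

definition L_quotient :: "('a, 'm) monoid_scheme \<Rightarrow> 'a set \<Rightarrow> 'a set monoid" where
  "L_quotient G H = G\<lparr>carrier := H\<rparr> Mod L_aut G H"

text \<open>
  The map \<open>(x L, \<alpha>) \<mapsto> [x, \<alpha>]\<close> on cosets. That the description is proper, i.e. that the
  value does not depend on the representative, is lemma \<open>autocomm_map_coset\<close> below.
\<close>

definition autocomm_map :: "('a, 'm) monoid_scheme \<Rightarrow> 'a set \<Rightarrow> 'a set \<times> ('a \<Rightarrow> 'a) \<Rightarrow> 'a" where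
  "autocomm_map G H =
     (\<lambda>(C, \<alpha>). THE c. \<exists>x \<in> H. C = x <#\<^bsub>G\<^esub> L_aut G H \<and> c = autocomm G x \<alpha>)"

text \<open>
  Maps between groups are total HOL functions, relevant only on carriers, so the two
  composites are compared on the product of the quotient with the automorphism group.
\<close>

definition autoisoclinism ::
  "('a, 'm) monoid_scheme \<Rightarrow> 'a set \<Rightarrow> ('b, 'n) monoid_scheme \<Rightarrow> 'b set \<Rightarrow>
   ('a set \<Rightarrow> 'b set) \<Rightarrow> (('a \<Rightarrow> 'a) \<Rightarrow> ('b \<Rightarrow> 'b)) \<Rightarrow> ('a \<Rightarrow> 'b) \<Rightarrow> bool" where
  "autoisoclinism G1 H1 G2 H2 \<psi> \<gamma> \<beta> \<longleftrightarrow>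
     \<psi> \<in> iso (L_quotient G1 H1) (L_quotient G2 H2) \<and>
     \<gamma> \<in> iso (AutoGroup G1) (AutoGroup G2) \<and>
     \<beta> \<in> iso (G1\<lparr>carrier := autocomm_subgroup G1 H1\<rparr>) (G2\<lparr>carrier := autocomm_subgroup G2 H2\<rparr>) \<and>
     (\<forall>p \<in> carrier (L_quotient G1 H1) \<times> carrier (AutoGroup G1).
        (\<beta> \<circ> autocomm_map G1 H1) p = (autocomm_map G2 H2 \<circ> map_prod \<psi> \<gamma>) p)"

context group
begin

lemma auto_mult:
  assumes "\<alpha> \<in> auto G" "x \<in> carrier G" "y \<in> carrier G"
  shows "\<alpha> (x \<otimes> y) = \<alpha> x \<otimes> \<alpha> y"
  using assms by (auto simp: auto_def hom_def)

lemma auto_closed: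
  assumes "\<alpha> \<in> auto G" "x \<in> carrier G"
  shows "\<alpha> x \<in> carrier G"
  using assms by (auto simp: auto_def hom_def)

lemma conjugation_in_auto:
  assumes g: "g \<in> carrier G"
  shows "(\<lambda>y \<in> carrier G. g \<otimes> y \<otimes> inv g) \<in> auto G"
proof -
  have inj: "inj_on (\<lambda>y \<in> carrier G. g \<otimes> y \<otimes> inv g) (carrier G)"
    using g by (auto intro!: inj_onI)
  have surj: "\<exists>x \<in> carrier G. y = g \<otimes> x \<otimes> inv g" if "y \<in> carrier G" for y
    using g that by (intro bexI[of _ "inv g \<otimes> y \<otimes> g"]) (simp_all add: m_assoc flip: m_assoc[of g "inv g"])
  have bij: "bij_betw (\<lambda>y \<in> carrier G. g \<otimes> y \<otimes> inv g) (carrier G) (carrier G)"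
    unfolding bij_betw_def
  proof
    show "(\<lambda>y \<in> carrier G. g \<otimes> y \<otimes> inv g) ` carrier G = carrier G"
      using g surj by (auto simp: image_iff)
  qed (rule inj)
  have "g \<otimes> (x \<otimes> y) \<otimes> inv g = (g \<otimes> x \<otimes> inv g) \<otimes> (g \<otimes> y \<otimes> inv g)"
    if "x \<in> carrier G" "y \<in> carrier G" for x y
  proof -
    have "inv g \<otimes> (g \<otimes> (y \<otimes> inv g)) = y \<otimes> inv g"
      using g that by (simp flip: m_assoc)
    then show ?thesis using g that by (simp add: m_assoc)
  qed
  with g bij show ?thesis
    by (auto simp: auto_def hom_def Bij_def)
qed

lemma L_aut_central:
  assumes H: "subgroup H G" and l: "l \<in> L_aut G H" and g: "g \<in> carrier G"
  shows "g \<otimes> l = l \<otimes> g"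
proof -
  have lc: "l \<in> carrier G"
    using l subgroup.subset[OF H] by (auto simp: L_aut_def)
  have "g \<otimes> l \<otimes> inv g = l"
    using l lc conjugation_in_auto[OF g] by (auto simp: L_aut_def)
  with g lc show ?thesis
    by (metis inv_closed inv_solve_right m_closed inv_inv)
qed

lemma auto_inv:
  assumes \<alpha>: "\<alpha> \<in> auto G" and x: "x \<in> carrier G"
  shows "\<alpha> (inv x) = inv (\<alpha> x)"
proof -
  have "group_hom G G \<alpha>"
    using \<alpha> by (unfold_locales) (auto simp: auto_def)
  then show ?thesis using x by (rule group_hom.hom_inv)
qed

lemma auto_one:
  assumes \<alpha>: "\<alpha> \<in> auto G"
  shows "\<alpha> \<one> = \<one>"
proof -
  have "group_hom G G \<alpha>"
    using \<alpha> by (unfold_locales) (auto simp: auto_def)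
  then show ?thesis by (rule group_hom.hom_one)
qed

lemma L_aut_fixed: "\<alpha> \<in> auto G \<Longrightarrow> x \<in> L_aut G H \<Longrightarrow> \<alpha> x = x"
  by (auto simp: L_aut_def)

lemma L_aut_subgroup:
  assumes H: "subgroup H G"
  shows "subgroup (L_aut G H) G"
proof -
  interpret H: subgroup H G by (rule H)
  show ?thesis
  proof (rule subgroupI)
    show "L_aut G H \<noteq> {}"
      using H.one_closed auto_one unfolding L_aut_def by blast
  next
    fix a b assume a: "a \<in> L_aut G H" and b: "b \<in> L_aut G H"
    then have "a \<in> H" "b \<in> H" by (auto simp: L_aut_def)
    moreover have "\<alpha> (a \<otimes> b) = a \<otimes> b" if "\<alpha> \<in> auto G" for \<alpha>
      using auto_mult[OF that, of a b] calculation L_aut_fixed[OF that a] L_aut_fixed[OF that b]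
      by simp
    ultimately show "a \<otimes> b \<in> L_aut G H" unfolding L_aut_def by blast
  qed (auto simp: L_aut_def auto_inv)
qed

lemma L_aut_cosets:
  assumes H: "subgroup H G" and x: "x \<in> carrier G"
  shows "L_aut G H #> x = x <# L_aut G H"
  unfolding r_coset_def l_coset_def
  by (rule SUP_cong) (simp_all add: L_aut_central[OF H _ x])

lemma L_aut_normal:
  assumes H: "subgroup H G"
  shows "L_aut G H \<lhd> G\<lparr>carrier := H\<rparr>"
proof (rule group.normalI)
  show "group (G\<lparr>carrier := H\<rparr>)"
    using H by (rule subgroup_imp_group)
  show "subgroup (L_aut G H) (G\<lparr>carrier := H\<rparr>)"
    using L_aut_subgroup[OF H] H by (rule subgroup_incl) (auto simp: L_aut_def)
  show "\<forall>x \<in> carrier (G\<lparr>carrier := H\<rparr>).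
          L_aut G H #>\<^bsub>G\<lparr>carrier := H\<rparr>\<^esub> x = x <#\<^bsub>G\<lparr>carrier := H\<rparr>\<^esub> L_aut G H"
    using L_aut_cosets[OF H] subgroup.subset[OF H] by (simp add: r_coset_def l_coset_def subset_iff)
qed

lemma carrier_L_quotient:
  assumes H: "subgroup H G"
  shows "carrier (L_quotient G H) = {x <# L_aut G H | x. x \<in> H}"
proof -
  have "L_aut G H #>\<^bsub>G\<lparr>carrier := H\<rparr>\<^esub> x = x <# L_aut G H" if "x \<in> H" for x
    using L_aut_cosets[OF H, of x] subgroup.subset[OF H] that
    by (auto simp: r_coset_def)
  then show ?thesis
    by (auto simp: L_quotient_def FactGroup_def RCOSETS_def)
qed

lemma autocomm_map_coset:
  assumes H: "subgroup H G" and x: "x \<in> H" and \<alpha>: "\<alpha> \<in> auto G"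
  shows "autocomm_map G H (x <# L_aut G H, \<alpha>) = autocomm G x \<alpha>"
proof -
  interpret H: subgroup H G by (rule H)
  interpret L: subgroup "L_aut G H" G by (rule L_aut_subgroup[OF H])
  have indep: "autocomm G y \<alpha> = autocomm G x \<alpha>"
    if y: "y \<in> H" and eq: "x <# L_aut G H = y <# L_aut G H" for y
  proof -
    have "y \<in> y <# L_aut G H"
      using y L.one_closed by (force simp: l_coset_def)
    with eq obtain l where l: "l \<in> L_aut G H" and yl: "y = x \<otimes> l"
      by (auto simp: l_coset_def)
    have lc: "l \<in> carrier G" and xc: "x \<in> carrier G" and ac: "\<alpha> x \<in> carrier G"
      using l x \<alpha> by (auto intro: auto_closed)
    have "\<alpha> y = l \<otimes> \<alpha> x"
      using auto_mult[OF \<alpha> xc lc] L_aut_fixed[OF \<alpha> l] L_aut_central[OF H l ac] yl by simp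
    moreover have "inv y = inv x \<otimes> inv l"
      unfolding yl L_aut_central[OF H l xc] using lc xc by (rule inv_mult_group)
    moreover have "inv l \<otimes> (l \<otimes> \<alpha> x) = \<alpha> x"
      using lc ac by (simp flip: m_assoc)
    ultimately show ?thesis
      using lc xc ac by (simp add: autocomm_def m_assoc)
  qed
  show ?thesis
    unfolding autocomm_map_def prod.case
    using x indep by (intro the_equality) blast+
qed

end

end

theory Submission
  imports Defs
begin

text \<open>
  An element \<open>x\<close> of \<open>H\<close> is fixed by \<open>\<alpha>\<close> exactly when \<open>[x, \<alpha>] = 1\<close>, and \<open>[x, \<alpha>]\<close> depends only on
  the coset of \<open>x\<close> modulo \<open>L = L(H, Aut(G))\<close>. So the fixed pairs in \<open>H \<times> Aut(G)\<close> come in blocks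
  \<open>C \<times> {\<alpha>}\<close>, each of size \<open>|L|\<close>, and \<open>Pr(H, Aut(G))\<close> is also the proportion of pairs \<open>(C, \<alpha>)\<close> in
  \<open>H/L \<times> Aut(G)\<close> that the commutator map sends to \<open>1\<close>: this is \<open>Pr_aut_eq_quotient\<close>.

  The latter proportion is visibly invariant under autoisoclinism. The bijection \<open>\<psi> \<times> \<gamma>\<close> matches
  the two sets of pairs, and it preserves and reflects triviality of the commutator because the
  commutator maps are intertwined by \<open>\<beta>\<close>, an injective homomorphism.
\<close>

context group
begin

lemma auto_fixes_iff_autocomm_one:
  assumes \<alpha>: "\<alpha> \<in> auto G" and x: "x \<in> carrier G"
  shows "\<alpha> x = x \<longleftrightarrow> autocomm G x \<alpha> = \<one>"
  using Units_l_cancel[of "inv x" "\<alpha> x" x] auto_closed[OF \<alpha> x] x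
  by (simp add: autocomm_def del: Units_l_cancel)

lemma group_restrict_autocomm_subgroup:
  assumes H: "subgroup H G"
  shows "group (G\<lparr>carrier := autocomm_subgroup G H\<rparr>)"
proof -
  have "{autocomm G x \<alpha> | x \<alpha>. x \<in> H \<and> \<alpha> \<in> auto G} \<subseteq> carrier G"
    using auto_closed subgroup.mem_carrier[OF H] by (auto simp: autocomm_def)
  then show ?thesis
    unfolding autocomm_subgroup_def
    by (intro subgroup_imp_group generate_is_subgroup)
qed

lemma autocomm_map_in_autocomm_subgroup:
  assumes H: "subgroup H G" and C: "C \<in> carrier (L_quotient G H)" and \<alpha>: "\<alpha> \<in> auto G"
  shows "autocomm_map G H (C, \<alpha>) \<in> autocomm_subgroup G H"
proof -
  obtain x where x: "x \<in> H" "C = x <# L_aut G H"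
    using C carrier_L_quotient[OF H] by auto
  then show ?thesis
    using autocomm_map_coset[OF H x(1) \<alpha>] \<alpha>
    unfolding autocomm_subgroup_def by (auto intro!: generate.incl)
qed

lemma L_quotient_eq_rcosets:
  "carrier (L_quotient G H) = rcosets\<^bsub>G\<lparr>carrier := H\<rparr>\<^esub> L_aut G H"
  by (simp add: L_quotient_def FactGroup_def)

text \<open>
  Any element of a coset may serve as its representative, so the value of the commutator map on a
  coset governs all of its elements at once.
\<close>

lemma autocomm_map_eq_autocomm_of_mem:
  assumes H: "subgroup H G" and C: "C \<in> carrier (L_quotient G H)"
    and x: "x \<in> C" and \<alpha>: "\<alpha> \<in> auto G"
  shows "autocomm_map G H (C, \<alpha>) = autocomm G x \<alpha>"
proof -
  interpret K: group "G\<lparr>carrier := H\<rparr>" using H by (rule subgroup_imp_group)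
  have L: "subgroup (L_aut G H) (G\<lparr>carrier := H\<rparr>)"
    using L_aut_normal[OF H] by (rule normal_imp_subgroup)
  obtain y where y: "y \<in> H" and Cy: "C = L_aut G H #>\<^bsub>G\<lparr>carrier := H\<rparr>\<^esub> y"
    using C by (auto simp: L_quotient_eq_rcosets RCOSETS_def)
  have xH: "x \<in> H"
    using C x K.rcosets_part_G[OF L] by (auto simp: L_quotient_eq_rcosets)
  have "C = L_aut G H #>\<^bsub>G\<lparr>carrier := H\<rparr>\<^esub> x"
    using K.repr_independence[OF _ _ L] x y Cy by simp
  also have "\<dots> = x <# L_aut G H"
    using L_aut_cosets[OF H] xH subgroup.subset[OF H] by (auto simp: r_coset_def)
  finally show ?thesis
    using autocomm_map_coset[OF H xH \<alpha>] by simp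
qed

text \<open>
  Every coset has \<open>|L|\<close> elements, and an automorphism fixes all of them or none. So numerator and
  denominator of the defining fraction of \<^term>\<open>Pr_aut G H\<close> are both \<open>|L|\<close> times those on the
  right, the denominator by Lagrange's theorem.
\<close>

lemma Pr_aut_eq_quotient:
  assumes fin: "finite (carrier G)" and H: "subgroup H G"
  shows "Pr_aut G H =
    real (card {p \<in> carrier (L_quotient G H) \<times> auto G. autocomm_map G H p = \<one>}) /
    (real (card (carrier (L_quotient G H))) * real (card (auto G)))"
proof -
  let ?K = "G\<lparr>carrier := H\<rparr>" and ?L = "L_aut G H" and ?Q = "carrier (L_quotient G H)"
  let ?F = "{p \<in> ?Q \<times> auto G. autocomm_map G H p = \<one>}"
  interpret K: group ?K using H by (rule subgroup_imp_group)
  have L: "subgroup ?L ?K"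
    using L_aut_normal[OF H] by (rule normal_imp_subgroup)
  have finH: "finite H"
    using fin subgroup.subset[OF H] by (rule rev_finite_subset)
  have union: "\<Union>?Q = H"
    using K.rcosets_part_G[OF L] by (simp add: L_quotient_eq_rcosets)
  have finQ: "finite ?Q"
    using finH union by (metis finite_UnionD)
  have card_coset: "card C = card ?L" if "C \<in> ?Q" for C
    using that K.card_rcosets_equal[of C ?L] subgroup.subset[OF L]
    by (simp add: L_quotient_eq_rcosets)
  have disj: "C \<inter> D = {}" if "C \<in> ?Q" "D \<in> ?Q" "C \<noteq> D" for C D
    using that K.rcos_disjoint[OF L] by (auto simp: L_quotient_eq_rcosets pairwise_def disjnt_def)
  have finA: "finite (auto G)"
  proof (rule finite_subset)
    show "auto G \<subseteq> carrier G \<rightarrow>\<^sub>E carrier G"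
      by (auto simp: auto_def Bij_def bij_betw_def PiE_def)
  qed (use fin in \<open>simp add: finite_PiE\<close>)
  have finC: "finite C" if "C \<in> ?Q" for C
    using that union finH by (auto intro: finite_subset)
  have fixed_iff: "\<alpha> x = x \<longleftrightarrow> autocomm_map G H (C, \<alpha>) = \<one>"
    if "C \<in> ?Q" "x \<in> C" "\<alpha> \<in> auto G" for C x \<alpha>
  proof -
    have "x \<in> carrier G"
      using that union subgroup.subset[OF H] by blast
    with that show ?thesis
      by (simp add: autocomm_map_eq_autocomm_of_mem[OF H] auto_fixes_iff_autocomm_one)
  qed
  have fixed_pairs: "{(x, \<alpha>). x \<in> H \<and> \<alpha> \<in> auto G \<and> \<alpha> x = x} = (\<Union>p \<in> ?F. fst p \<times> {snd p})"
  proof (intro subset_antisym subsetI)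
    fix z assume z: "z \<in> {(x, \<alpha>). x \<in> H \<and> \<alpha> \<in> auto G \<and> \<alpha> x = x}"
    obtain x \<alpha> where x\<alpha>: "z = (x, \<alpha>)" by (cases z)
    from z x\<alpha> have "x \<in> H" by simp
    then obtain C where C: "C \<in> ?Q" "x \<in> C"
      using union by blast
    with z have "(C, \<alpha>) \<in> ?F"
      by (simp add: x\<alpha> fixed_iff[symmetric])
    then show "z \<in> (\<Union>p \<in> ?F. fst p \<times> {snd p})"
      by (rule UN_I) (simp add: x\<alpha> C)
  next
    fix z assume "z \<in> (\<Union>p \<in> ?F. fst p \<times> {snd p})"
    then obtain C x \<alpha> where p: "(C, \<alpha>) \<in> ?F" and x: "x \<in> C" and z: "z = (x, \<alpha>)"
      by auto
    from p x have "x \<in> H" using union by blast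
    with p x show "z \<in> {(x, \<alpha>). x \<in> H \<and> \<alpha> \<in> auto G \<and> \<alpha> x = x}"
      by (simp add: z fixed_iff[of C])
  qed
  have "card {(x, \<alpha>). x \<in> H \<and> \<alpha> \<in> auto G \<and> \<alpha> x = x} = (\<Sum>p \<in> ?F. card (fst p \<times> {snd p}))"
    unfolding fixed_pairs
  proof (rule card_UN_disjoint)
    show "finite ?F" using finQ finA by simp
    show "\<forall>p \<in> ?F. finite (fst p \<times> {snd p})"
      using finC by (simp add: mem_Times_iff)
    show "\<forall>p \<in> ?F. \<forall>q \<in> ?F. p \<noteq> q \<longrightarrow> (fst p \<times> {snd p}) \<inter> (fst q \<times> {snd q}) = {}"
    proof (intro ballI impI)
      fix p q assume "p \<in> ?F" "q \<in> ?F" "p \<noteq> q"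
      then have "snd p \<noteq> snd q \<or> fst p \<inter> fst q = {}"
        using disj[of "fst p" "fst q"] by (auto simp: mem_Times_iff prod_eq_iff)
      then show "(fst p \<times> {snd p}) \<inter> (fst q \<times> {snd q}) = {}"
        by (auto simp: Times_Int_Times)
    qed
  qed
  also have "\<dots> = (\<Sum>p \<in> ?F. card ?L)"
    by (rule sum.cong) (simp_all add: card_cartesian_product card_coset mem_Times_iff)
  finally have num: "card {(x, \<alpha>). x \<in> H \<and> \<alpha> \<in> auto G \<and> \<alpha> x = x} = card ?F * card ?L"
    by simp
  have den: "card H = card ?Q * card ?L"
    using K.lagrange[OF L] by (simp add: order_def L_quotient_eq_rcosets)
  have "card ?L \<noteq> 0"
    using finH subgroup.one_closed[OF L] by (auto simp: L_aut_def)
  then show ?thesis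
    unfolding Pr_aut_def num den by simp
qed

end

theorem theorem4p2:
  fixes G1 :: "('a, 'm) monoid_scheme" and G2 :: "('b, 'n) monoid_scheme"
    and H1 :: "'a set" and H2 :: "'b set"
    and \<psi> :: "'a set \<Rightarrow> 'b set"
    and \<gamma> :: "('a \<Rightarrow> 'a) \<Rightarrow> ('b \<Rightarrow> 'b)"
    and \<beta> :: "'a \<Rightarrow> 'b"
  assumes "group G1" and "finite (carrier G1)"
    and "group G2" and "finite (carrier G2)"
    and "subgroup H1 G1" and "subgroup H2 G2"
    and "autoisoclinism G1 H1 G2 H2 \<psi> \<gamma> \<beta>"
  shows "Pr_aut G1 H1 = Pr_aut G2 H2"
proof -
  let ?Q1 = "carrier (L_quotient G1 H1)" and ?Q2 = "carrier (L_quotient G2 H2)"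
  let ?S1 = "autocomm_subgroup G1 H1" and ?S2 = "autocomm_subgroup G2 H2"
  interpret G1: group G1 by fact
  interpret G2: group G2 by fact
  have \<psi>: "bij_betw \<psi> ?Q1 ?Q2" and \<gamma>: "bij_betw \<gamma> (auto G1) (auto G2)"
    and \<beta>: "\<beta> \<in> iso (G1\<lparr>carrier := ?S1\<rparr>) (G2\<lparr>carrier := ?S2\<rparr>)"
    and comm: "\<And>p. p \<in> ?Q1 \<times> auto G1 \<Longrightarrow>
      autocomm_map G2 H2 (map_prod \<psi> \<gamma> p) = \<beta> (autocomm_map G1 H1 p)"
    using assms(7) by (auto simp: autoisoclinism_def iso_def AutoGroup_def)
  interpret S1: group "G1\<lparr>carrier := ?S1\<rparr>"
    using assms(5) by (rule G1.group_restrict_autocomm_subgroup)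
  interpret S2: group "G2\<lparr>carrier := ?S2\<rparr>"
    using assms(6) by (rule G2.group_restrict_autocomm_subgroup)
  interpret \<beta>: group_hom "G1\<lparr>carrier := ?S1\<rparr>" "G2\<lparr>carrier := ?S2\<rparr>" \<beta>
    using \<beta> by unfold_locales (simp add: iso_def)
  have inj: "inj_on \<beta> ?S1"
    using \<beta> by (simp add: iso_def bij_betw_def)
  have trivial_iff: "\<beta> s = \<one>\<^bsub>G2\<^esub> \<longleftrightarrow> s = \<one>\<^bsub>G1\<^esub>" if "s \<in> ?S1" for s
    using inj_on_eq_iff[OF inj that, of "\<one>\<^bsub>G1\<^esub>"] \<beta>.hom_one S1.one_closed by simp
  have bij: "bij_betw (map_prod \<psi> \<gamma>) (?Q1 \<times> auto G1) (?Q2 \<times> auto G2)"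
    using \<psi> \<gamma> by (rule bij_betw_map_prod)
  have "bij_betw (map_prod \<psi> \<gamma>)
     {p \<in> ?Q1 \<times> auto G1. autocomm_map G1 H1 p = \<one>\<^bsub>G1\<^esub>}
     {p \<in> ?Q2 \<times> auto G2. autocomm_map G2 H2 p = \<one>\<^bsub>G2\<^esub>}"
  proof (rule bij_betw_Collect[OF bij])
    fix p assume p: "p \<in> ?Q1 \<times> auto G1"
    then have "autocomm_map G1 H1 p \<in> ?S1"
      using G1.autocomm_map_in_autocomm_subgroup[OF assms(5)] by auto
    then show "autocomm_map G2 H2 (map_prod \<psi> \<gamma> p) = \<one>\<^bsub>G2\<^esub> \<longleftrightarrow> autocomm_map G1 H1 p = \<one>\<^bsub>G1\<^esub>"
      by (simp add: comm[OF p] trivial_iff)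
  qed
  then show ?thesis
    unfolding G1.Pr_aut_eq_quotient[OF assms(2,5)] G2.Pr_aut_eq_quotient[OF assms(4,6)]
    by (simp add: bij_betw_same_card[OF \<psi>] bij_betw_same_card[OF \<gamma>] bij_betw_same_card)
qed

end
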